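(* Let $n\ge 2$, $1\le j\le n$, and let $\mathcal{S}_1,\mathcal{S}_2$ be $n$-tuples of polynomials in $\mathbb{R}[x_1,\dots,x_n]$ with $T_{[x_j]}(\mathcal{S}_1)\le T_{[x_j]}(\mathcal{S}_2)$. If there exists some $s\in\mathbb{N}$ such that $T_{[x_j]}^s(\mathcal{S}_2)\le T_{[x_j]}(\mathcal{S}_1)$, then $$s+1=\big[T_{[x_j]}(\mathcal{S}_2):T_{[x_j]}(\mathcal{S}_1)\big]+\big[T_{[x_j]}(\mathcal{S}_1):T_{[x_j]}^s(\mathcal{S}_2)\big].$$
   Context: Tuples are $n$-tuples $\mathcal{S}=(f_1,\dots,f_n)$ of polynomials in $\mathbb{R}[x_1,\dots,x_n]$, $n\ge2$. The expansion in the direction $x_j$ is the operator $T_{[x_j]}:=(\gamma^{-1}\circ\beta\circ\gamma\circ\nabla)_{[x_j]}$, where $\nabla_{[x_j]}(\mathcal{S})=(\partial f_1/\partial x_j,\dots,\partial f_n/\partial x_j)$, $\gamma$ turns a tuple into a column vector and $\beta$ multiplies by the $n\times n$ matrix with $0$ on the diagonal and $1$ elsewhere; so the $r$-th entry of $T_{[x_j]}(\mathcal{S})$ is $\sum_{t\ne r}\partial f_t/\partial x_j$. $T_{[x_j]}^k$ is the $k$-fold iterate. Sub-expansion: $T_{[x_j]}^k(\mathcal{S}_z)\le T_{[x_j]}^l(\mathcal{S}_t)$ means there exists some $m\ge 0$ with $T_{[x_j]}^k(\mathcal{S}_z)=T_{[x_j]}^{k+m}(\mathcal{S}_t)$. Index: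 $[T_{[x_j]}(\mathcal{S}_t):T_{[x_j]}(\mathcal{S}_z)]$ is the value of $r\in\mathbb{N}$ such that $T_{[x_j]}(\mathcal{S}_z)=T_{[x_j]}^r(\mathcal{S}_t)$ (and is $\infty$ if no such $r$ exists). Likewise $[T_{[x_j]}(\mathcal{S}_1):T_{[x_j]}^s(\mathcal{S}_2)]$ is the value of $r\in\mathbb{N}$ such that $T_{[x_j]}^s(\mathcal{S}_2)=T_{[x_j]}^r(\mathcal{S}_1)$.
   Formalization: It is additionally assumed that at most one r qualifies as "the value of r" in each of the two indices; without this they are ill-defined, e.g. for S_1 = S_2 = 0 every r qualifies and every s satisfies the hypotheses. *)

theory Defs
  imports
    "HOL-Library.Poly_Mapping"
    "HOL-Library.Extended_Nat"
    "HOL-Analysis.Finite_Cartesian_Product"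
begin

text \<open>
  \<open>'n mpoly\<close> is the polynomial ring over the reals in the variables \<open>x\<^sub>i\<close>, \<open>i :: 'n\<close>: finitely
  supported maps from monomials (exponent vectors) to coefficients, multiplied by convolution.
  The same finite type indexes variables and tuple entries, so the number \<open>n\<close> of both is
  \<open>CARD('n)\<close>.
\<close>

type_synonym 'n mpoly = "('n \<Rightarrow>\<^sub>0 nat) \<Rightarrow>\<^sub>0 real"

type_synonym 'n tuple = "'n mpoly ^ 'n"

text \<open>
  Termwise differentiation. The subtraction of exponents truncates only where \<open>x\<^sub>j\<close> does not
  occur in the monomial, and there the coefficient is \<open>0\<close>.
\<close>

definition partial :: "'n \<Rightarrow> 'n mpoly \<Rightarrow> 'n mpoly" where
  "partial j f =
     (\<Sum>m\<in>Poly_Mapping.keys f.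
        Poly_Mapping.single (m - Poly_Mapping.single j 1)
          (of_nat (Poly_Mapping.lookup m j) * Poly_Mapping.lookup f m))"

lemma lookup_partial:
  "Poly_Mapping.lookup (partial j f) m =
     of_nat (Poly_Mapping.lookup m j + 1) * Poly_Mapping.lookup f (m + Poly_Mapping.single j 1)"
proof -
  let ?e = "Poly_Mapping.single j (1::nat)"
  have "Poly_Mapping.lookup (partial j f) m =
      (\<Sum>k\<in>Poly_Mapping.keys f.
         (of_nat (Poly_Mapping.lookup k j) * Poly_Mapping.lookup f k when k - ?e = m))"
    by (simp add: partial_def lookup_sum lookup_single)
  also have "\<dots> = (\<Sum>k\<in>Poly_Mapping.keys f. if k = m + ?e
      then of_nat (Poly_Mapping.lookup k j) * Poly_Mapping.lookup f k else 0)"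
  proof (rule sum.cong[OF refl])
    fix k
    show "(of_nat (Poly_Mapping.lookup k j) * Poly_Mapping.lookup f k when k - ?e = m) =
      (if k = m + ?e then of_nat (Poly_Mapping.lookup k j) * Poly_Mapping.lookup f k else 0)"
    proof (cases "Poly_Mapping.lookup k j = 0")
      case False
      then have "(k - ?e) + ?e = k"
        by (intro poly_mapping_eqI) (auto simp: lookup_add lookup_minus lookup_single when_def)
      then have "k - ?e = m \<longleftrightarrow> k = m + ?e"
        by auto
      then show ?thesis by simp
    qed (auto simp: lookup_add)
  qed
  also have "\<dots> = of_nat (Poly_Mapping.lookup m j + 1) * Poly_Mapping.lookup f (m + ?e)"
    by (simp add: lookup_add in_keys_iff)
  finally show ?thesis .
qed

definition nabla :: "'n::finite \<Rightarrow> 'n tuple \<Rightarrow> 'n tuple" where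
  "nabla j S = (\<chi> i. partial j (S $ i))"

definition beta_matrix :: "'n::finite mpoly ^ 'n ^ 'n" where
  "beta_matrix = (\<chi> r t. if r = t then 0 else 1)"

text \<open>
  The map \<open>\<gamma>\<close>, which reads a tuple as a column vector, is the identity here, since
  tuples already have a vector type.
\<close>

definition expansion :: "'n::finite \<Rightarrow> 'n tuple \<Rightarrow> 'n tuple" where
  "expansion j S = beta_matrix *v nabla j S"

lemma expansion_nth: "expansion j S $ r = (\<Sum>t\<in>UNIV - {r}. partial j (S $ t))"
proof -
  have "expansion j S $ r = (\<Sum>t\<in>UNIV. if r = t then 0 else partial j (S $ t))"
    by (auto simp: expansion_def beta_matrix_def nabla_def matrix_vector_mult_def intro!: sum.cong)
  also have "\<dots> = (\<Sum>t\<in>UNIV - {r}. partial j (S $ t))"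
    by (rule sum.mono_neutral_cong_right) auto
  finally show ?thesis .
qed

text \<open>
  \<open>sub_expansion j k Sz l St\<close> is \<open>T\<^sup>k(Sz) \<le> T\<^sup>l(St)\<close> for \<open>T\<close> the expansion in direction \<open>x\<^sub>j\<close>.
  The exponent on the right-hand side is \<open>k + m\<close>, so the condition does not depend on \<open>l\<close>.
\<close>

definition sub_expansion :: "'n::finite \<Rightarrow> nat \<Rightarrow> 'n tuple \<Rightarrow> nat \<Rightarrow> 'n tuple \<Rightarrow> bool" where
  "sub_expansion j k Sz l St \<longleftrightarrow>
     (\<exists>m\<ge>0. (expansion j ^^ k) Sz = (expansion j ^^ (k + m)) St)"

text \<open>
  \<open>expansion_index j St k Sz\<close> is the index \<open>[T(St) : T\<^sup>k(Sz)]\<close>. The exponent \<open>r\<close> is counted from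
  \<open>St\<close>, not from \<open>T(St)\<close>. ``The value of \<open>r\<close>'' is a definite description, meaningful only if at most
  one \<open>r\<close> qualifies, which is what \<open>index_unambiguous\<close> says. This can fail: iterating \<open>T\<close> sends
  every tuple to \<open>0\<close> eventually, and if \<open>T\<^sup>k(Sz) = 0\<close> then every large \<open>r\<close> qualifies.
\<close>

definition index_unambiguous :: "'n::finite \<Rightarrow> 'n tuple \<Rightarrow> nat \<Rightarrow> 'n tuple \<Rightarrow> bool" where
  "index_unambiguous j St k Sz \<longleftrightarrow>
     (\<exists>\<^sub>\<le>\<^sub>1 r. (expansion j ^^ k) Sz = (expansion j ^^ r) St)"

definition expansion_index :: "'n::finite \<Rightarrow> 'n tuple \<Rightarrow> nat \<Rightarrow> 'n tuple \<Rightarrow> enat" where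
  "expansion_index j St k Sz =
     (if \<exists>r. (expansion j ^^ k) Sz = (expansion j ^^ r) St
      then enat (THE r. (expansion j ^^ k) Sz = (expansion j ^^ r) St)
      else \<infinity>)"

end

theory Submission
  imports Defs
begin

text \<open>
  Write \<open>T\<close> for the expansion in the direction \<open>x\<^sub>j\<close>. Each application of \<open>T\<close> differentiates every
  entry once in \<open>x\<^sub>j\<close>, so it lowers the degree in \<open>x\<^sub>j\<close>, and on each tuple \<open>T\<close> is eventually zero
  (\<open>expansion_eventually_zero\<close>). Hence \<open>T\<close> has no periodic point other than \<open>0\<close>
  (\<open>expansion_periodic_imp_zero\<close>).

  The two hypotheses on sub-expansions give \<open>T S\<^sub>1 = T\<^bsup>1+m\<^esup> S\<^sub>2\<close> and \<open>T\<^sup>s S\<^sub>2 = T\<^bsup>s+k\<^esup> S\<^sub>1\<close>, so the two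
  indices are \<open>1 + m\<close> and \<open>s + k\<close>, and the claim amounts to \<open>m = k = 0\<close>. Chaining the equations
  shows that \<open>T\<^sup>s S\<^sub>2\<close>, or \<open>T S\<^sub>1\<close> in the degenerate case \<open>s = k = 0\<close>, is fixed by a power of \<open>T\<close> with
  exponent \<open>m + k\<close>. If \<open>m + k\<close> were positive, this tuple would be \<open>0\<close>. But the index of the zero
  tuple is ambiguous, because every large power of \<open>T\<close> attains it
  (\<open>index_unambiguous_imp_nonzero\<close>).
\<close>

lemma expansion_zero: "expansion j 0 = 0"
  by (simp add: vec_eq_iff expansion_nth partial_def)

lemma expansion_funpow_zero: "(expansion j ^^ k) 0 = 0"
  by (induction k) (simp_all add: expansion_zero)

text \<open>
  The hypothesis says that all entries have degree less than \<open>N\<close> in \<open>x\<^sub>j\<close>, where degree less than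
  \<open>0\<close> means being zero. In this form one application of \<open>T\<close> lowers the bound by exactly one, and
  the bound \<open>0\<close> is the conclusion.
\<close>

lemma expansion_funpow_eq_zero:
  assumes "\<And>i m. N \<le> Poly_Mapping.lookup m j \<Longrightarrow> Poly_Mapping.lookup (S $ i) m = 0"
  shows "(expansion j ^^ N) S = 0"
  using assms
proof (induction N arbitrary: S)
  case 0
  then show ?case
    by (auto simp: vec_eq_iff intro!: poly_mapping_eqI)
next
  case (Suc N)
  have "Poly_Mapping.lookup (expansion j S $ i) m = 0" if "N \<le> Poly_Mapping.lookup m j" for i m
    using that Suc.prems
    by (simp add: expansion_nth lookup_sum lookup_partial lookup_add)
  then have "(expansion j ^^ N) (expansion j S) = 0"
    by (rule Suc.IH)
  then show ?case
    by (simp add: funpow_swap1)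
qed

lemma expansion_eventually_zero:
  "\<exists>N. \<forall>k\<ge>N. (expansion j ^^ k) S = 0"
proof -
  define M where "M = (\<lambda>m. Poly_Mapping.lookup m j) ` (\<Union>i. Poly_Mapping.keys (S $ i))"
  have "finite M"
    by (simp add: M_def)
  then obtain N where N: "\<And>d. d \<in> M \<Longrightarrow> d < N"
    by (auto simp: finite_nat_set_iff_bounded)
  have "Poly_Mapping.lookup (S $ i) m = 0" if "N \<le> Poly_Mapping.lookup m j" for i m
  proof (rule ccontr)
    assume "Poly_Mapping.lookup (S $ i) m \<noteq> 0"
    then have "Poly_Mapping.lookup m j \<in> M"
      unfolding M_def by (intro imageI UN_I[of i]) (auto simp: in_keys_iff)
    with N that show False
      by (meson not_le)
  qed
  then have zero: "(expansion j ^^ N) S = 0"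
    by (rule expansion_funpow_eq_zero)
  have "(expansion j ^^ k) S = 0" if "N \<le> k" for k
  proof -
    have "(expansion j ^^ k) S = (expansion j ^^ (k - N)) ((expansion j ^^ N) S)"
      using that funpow_add[of "k - N" N "expansion j"] by simp
    then show ?thesis
      by (simp add: zero expansion_funpow_zero)
  qed
  then show ?thesis
    by blast
qed

lemma expansion_periodic_imp_zero:
  assumes periodic: "(expansion j ^^ p) S = S" and "p > 0"
  shows "S = 0"
proof -
  obtain N where N: "\<And>k. N \<le> k \<Longrightarrow> (expansion j ^^ k) S = 0"
    using expansion_eventually_zero[of j S] by blast
  have "((expansion j ^^ p) ^^ q) S = S" for q
    by (induction q) (simp_all add: periodic)
  then have "(expansion j ^^ (p * N)) S = S"
    by (simp add: funpow_mult mult.commute)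
  moreover have "N \<le> p * N"
    using \<open>p > 0\<close> by simp
  ultimately show ?thesis
    using N by metis
qed

lemma index_unambiguous_imp_nonzero:
  assumes "index_unambiguous j St k Sz"
  shows "(expansion j ^^ k) Sz \<noteq> 0"
proof
  assume zero: "(expansion j ^^ k) Sz = 0"
  obtain N where N: "\<And>k. N \<le> k \<Longrightarrow> (expansion j ^^ k) St = 0"
    using expansion_eventually_zero[of j St] by blast
  have "N = Suc N"
    using assms zero N[of N] N[of "Suc N"] unfolding index_unambiguous_def Uniq_def
    by (metis le_refl le_SucI)
  then show False
    by simp
qed

lemma expansion_index_eq:
  assumes "index_unambiguous j St k Sz" and "(expansion j ^^ k) Sz = (expansion j ^^ r) St"
  shows "expansion_index j St k Sz = enat r"
  using assms the1_equality'[of "\<lambda>r. (expansion j ^^ k) Sz = (expansion j ^^ r) St" r]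
  by (auto simp: expansion_index_def index_unambiguous_def)

theorem theorem10p7:
  fixes S1 S2 :: "'n::finite tuple" and j :: 'n and s :: nat
  assumes "CARD('n) \<ge> 2"
    and "sub_expansion j 1 S1 1 S2"
    and "sub_expansion j s S2 1 S1"
    and "index_unambiguous j S2 1 S1"
    and "index_unambiguous j S1 s S2"
  shows "enat (s + 1) = expansion_index j S2 1 S1 + expansion_index j S1 s S2"
proof -
  let ?T = "expansion j"
  have comp: "(?T ^^ (a + b)) S = (?T ^^ a) ((?T ^^ b) S)" for a b S
    by (simp add: funpow_add)
  obtain m where m: "(?T ^^ 1) S1 = (?T ^^ (1 + m)) S2"
    using assms(2) unfolding sub_expansion_def by blast
  obtain k where k: "(?T ^^ s) S2 = (?T ^^ (s + k)) S1"
    using assms(3) unfolding sub_expansion_def by blast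
  have "m + k = 0"
  proof (rule ccontr)
    assume pos: "m + k \<noteq> 0"
    show False
    proof (cases "s + k")
      case 0
      \<comment> \<open>Here \<open>S\<^sub>1 = S\<^sub>2\<close>, but the first equation starts at \<open>T S\<^sub>1\<close>, so only \<open>T S\<^sub>1\<close> is seen to be periodic.\<close>
      then have "(?T ^^ m) ((?T ^^ 1) S1) = (?T ^^ 1) S1"
        using k m comp[of m 1 S1] by (simp add: add.commute)
      then have "(?T ^^ 1) S1 = 0"
        using pos 0 by (intro expansion_periodic_imp_zero[where p = m]) auto
      then show False
        using index_unambiguous_imp_nonzero[OF assms(4)] by contradiction
    next
      case (Suc q)
      have "(?T ^^ s) S2 = (?T ^^ q) ((?T ^^ 1) S1)"
        using k Suc comp[of q 1 S1] by simp
      also have "\<dots> = (?T ^^ (q + (1 + m))) S2"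
        by (simp only: m comp)
      also have "q + (1 + m) = (m + k) + s"
        using Suc by simp
      also have "(?T ^^ ((m + k) + s)) S2 = (?T ^^ (m + k)) ((?T ^^ s) S2)"
        by (rule comp)
      finally have "(?T ^^ (m + k)) ((?T ^^ s) S2) = (?T ^^ s) S2"
        by (rule sym)
      then have "(?T ^^ s) S2 = 0"
        using pos by (intro expansion_periodic_imp_zero[where p = "m + k"]) auto
      then show False
        using index_unambiguous_imp_nonzero[OF assms(5)] by contradiction
    qed
  qed
  then show ?thesis
    using expansion_index_eq[OF assms(4) m] expansion_index_eq[OF assms(5) k] by simp
qed

end
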